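(* Let $f,g,t\geq 1$ be integers. Let $G$ be a $K_t$-free graph. Assume that there is a $(Z_0,f+g,t)$-phantom in $G$ for some $2$-clique $Z_0\subseteq V(G)$. Then there is an $(f,g)$-crystal in $G$.
   Context: Graphs are finite and simple; a $c$-clique is a clique of size $c$; $[n]=\{1,\ldots,n\}$. For $Z_0\subseteq V(G)$ and integers $d\geq1$, $r\geq0$, a $(Z_0,d,r)$-phantom in $G$ is a tuple $(Z_0,\ldots,Z_r;\Gamma_i:i\in[r])$ with $Z_0\subseteq\cdots\subseteq Z_r\subseteq V(G)$ such that for every $i\in[r]$, $\Gamma_i$ is a map with domain $E(G[Z_{i-1}])$, where for each edge $e$, $\Gamma_i(e)\subseteq Z_i\setminus Z_{i-1}$, $|\Gamma_i(e)|=d$, both ends of $e$ are adjacent to all of $\Gamma_i(e)$, and distinct edges have disjoint images. For adjacent $z_1,z_2\in V(G)$, a $(z_1,z_2,f,g)$-crystal in $G$ is a tuple $(S_{1,z},z,S_{2,z}:z\in S)$ with $S$ an $f$-subset of $V(G)\setminus\{z_1,z_2\}$, the sets $S_{1,z},S_{2,z}$ ($z\in S$) pairwise disjoint $g$-subsets of $V(G)\setminus(S\cup\{z_1,z_2\})$, and for each $i\in\{1,2\}$, $z\in S$, $x\in S_{i,z}$, the neighbors of $x$ in $\{z_1,z_2,z\}$ are exactly $\{z_i,z\}$. An $(f,g)$-crystal is a $(z_1,z_2,f,g)$-crystal for some adjacent pair $z_1,z_2$. *)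

theory Defs
  imports Main "HOL-Library.Ramsey" "HOL-Library.Disjoint_Sets"
begin

text \<open>
  A graph is given by its vertex set \<open>V\<close> and its set \<open>E\<close> of edges, an edge being the two-element
  set of its ends. Thus \<open>u\<close> and \<open>v\<close> are adjacent iff \<open>{u, v} \<in> E\<close>.
\<close>

definition fin_simple_graph :: "'a set \<Rightarrow> 'a set set \<Rightarrow> bool" where
  "fin_simple_graph V E \<longleftrightarrow> finite V \<and> E \<subseteq> [V]\<^bsup>2\<^esup>"

definition is_clique_of_size :: "'a set \<Rightarrow> 'a set set \<Rightarrow> nat \<Rightarrow> 'a set \<Rightarrow> bool" where
  "is_clique_of_size V E c K \<longleftrightarrow> K \<in> [V]\<^bsup>c\<^esup> \<and> clique K E"

definition clique_free :: "'a set \<Rightarrow> 'a set set \<Rightarrow> nat \<Rightarrow> bool" where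
  "clique_free V E t \<longleftrightarrow> (\<nexists>K. is_clique_of_size V E t K)"

definition neighbors :: "'a set set \<Rightarrow> 'a \<Rightarrow> 'a set" where
  "neighbors E x = {y. {x, y} \<in> E}"

definition induced_edges :: "'a set set \<Rightarrow> 'a set \<Rightarrow> 'a set set" where
  "induced_edges E X = {e \<in> E. e \<subseteq> X}"

text \<open>
  The tuple \<open>(Z\<^sub>0, \<dots>, Z\<^sub>r; \<Gamma>\<^sub>i : i \<in> [r])\<close> is represented by total functions \<open>Z\<close> and \<open>\<Gamma>\<close>; the values
  of \<open>Z\<close> beyond \<open>r\<close>, of \<open>\<Gamma>\<close> outside \<open>{1..r}\<close>, and of \<open>\<Gamma> i\<close> outside the edge set of the subgraph
  induced on \<open>Z (i - 1)\<close> are irrelevant.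
\<close>

definition is_phantom ::
  "'a set \<Rightarrow> 'a set set \<Rightarrow> 'a set \<Rightarrow> nat \<Rightarrow> nat \<Rightarrow> (nat \<Rightarrow> 'a set) \<Rightarrow> (nat \<Rightarrow> 'a set \<Rightarrow> 'a set) \<Rightarrow> bool"
where
  "is_phantom V E Z\<^sub>0 d r Z \<Gamma> \<longleftrightarrow>
     Z 0 = Z\<^sub>0 \<and> (\<forall>i\<in>{1..r}. Z (i - 1) \<subseteq> Z i) \<and> Z r \<subseteq> V \<and>
     (\<forall>i\<in>{1..r}.
        (\<forall>e\<in>induced_edges E (Z (i - 1)).
           \<Gamma> i e \<in> [Z i - Z (i - 1)]\<^bsup>d\<^esup> \<and> (\<forall>v\<in>e. \<Gamma> i e \<subseteq> neighbors E v)) \<and>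
        disjoint_family_on (\<Gamma> i) (induced_edges E (Z (i - 1))))"

definition has_phantom :: "'a set \<Rightarrow> 'a set set \<Rightarrow> 'a set \<Rightarrow> nat \<Rightarrow> nat \<Rightarrow> bool" where
  "has_phantom V E Z\<^sub>0 d r \<longleftrightarrow> (\<exists>Z \<Gamma>. is_phantom V E Z\<^sub>0 d r Z \<Gamma>)"

text \<open>
  In a crystal, \<open>T i z\<close> stands for \<open>S\<^bsub>i,z\<^esub>\<close>. Disjointness is that of the family indexed by all
  pairs \<open>(i, z)\<close> with \<open>i \<in> {1, 2}\<close> and \<open>z \<in> S\<close>.
\<close>

definition is_crystal ::
  "'a set \<Rightarrow> 'a set set \<Rightarrow> 'a \<Rightarrow> 'a \<Rightarrow> nat \<Rightarrow> nat \<Rightarrow> 'a set \<Rightarrow> (nat \<Rightarrow> 'a \<Rightarrow> 'a set) \<Rightarrow> bool"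
where
  "is_crystal V E z\<^sub>1 z\<^sub>2 f g S T \<longleftrightarrow>
     S \<in> [V - {z\<^sub>1, z\<^sub>2}]\<^bsup>f\<^esup> \<and>
     (\<forall>i\<in>{1, 2}. \<forall>z\<in>S. T i z \<in> [V - (S \<union> {z\<^sub>1, z\<^sub>2})]\<^bsup>g\<^esup>) \<and>
     disjoint_family_on (\<lambda>(i, z). T i z) ({1, 2} \<times> S) \<and>
     (\<forall>z\<in>S. \<forall>x\<in>T 1 z. neighbors E x \<inter> {z\<^sub>1, z\<^sub>2, z} = {z\<^sub>1, z}) \<and>
     (\<forall>z\<in>S. \<forall>x\<in>T 2 z. neighbors E x \<inter> {z\<^sub>1, z\<^sub>2, z} = {z\<^sub>2, z})"

definition has_crystal :: "'a set \<Rightarrow> 'a set set \<Rightarrow> nat \<Rightarrow> nat \<Rightarrow> bool" where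
  "has_crystal V E f g \<longleftrightarrow>
     (\<exists>z\<^sub>1\<in>V. \<exists>z\<^sub>2\<in>V. {z\<^sub>1, z\<^sub>2} \<in> E \<and> (\<exists>S T. is_crystal V E z\<^sub>1 z\<^sub>2 f g S T))"

end

theory Submission
  imports Defs
begin

text \<open>
  Call everything that the phantom grows, level after level, from an edge \<open>e\<close> the growth of \<open>e\<close>;
  distinct edges of the same level have disjoint growths. If there is no crystal, then fewer than
  \<open>f\<close> of the \<open>f + g\<close> vertices \<open>v\<close> attached to an edge \<open>xy\<close> have at least \<open>g\<close> vertices in the growth of
  \<open>vx\<close> that are adjacent to \<open>v, x\<close> but not to \<open>y\<close>, and likewise with \<open>x, y\<close> exchanged. So for more
  than \<open>g\<close> of these \<open>v\<close> one of the edges, say \<open>vx\<close>, has fewer than \<open>g\<close> such vertices.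

  This lets a clique \<open>K\<close> gain one vertex per level. The invariant is that \<open>K\<close> contains an edge \<open>xy\<close>
  such that all but fewer than \<open>g\<close> of the vertices in the growth of \<open>xy\<close> that are adjacent to \<open>x, y\<close>
  are adjacent to all of \<open>K\<close>. By the pigeonhole principle, one of the more than \<open>g\<close> vertices \<open>v\<close>
  above is not an exception and has no exception in the growths of \<open>vx\<close> and \<open>vy\<close>; then
  \<open>K \<union> {v}\<close> with the edge \<open>vx\<close> satisfies the invariant again, because being adjacent to \<open>v, x\<close> implies
  being adjacent to \<open>y\<close> with fewer than \<open>g\<close> exceptions, and hence to \<open>K\<close> with no further ones.
\<close>

section \<open>Levels of a phantom and the sets attached to edges\<close>

locale phantom =
  fixes V :: "'a set" and E :: "'a set set" and Z\<^sub>0 :: "'a set" and d r :: nat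
    and Z :: "nat \<Rightarrow> 'a set" and \<Gamma> :: "nat \<Rightarrow> 'a set \<Rightarrow> 'a set"
  assumes graph: "fin_simple_graph V E" and phantom: "is_phantom V E Z\<^sub>0 d r Z \<Gamma>"
begin

abbreviation edges :: "nat \<Rightarrow> 'a set set" where
  "edges i \<equiv> induced_edges E (Z i)"

lemma finite_V: "finite V"
  using graph by (simp add: fin_simple_graph_def)

lemma edge_neq: "{x, y} \<in> E \<Longrightarrow> x \<noteq> y"
  using graph by (auto simp: fin_simple_graph_def nsets_def)

lemma phantom_step:
  assumes "i < r"
  shows "Z i \<subseteq> Z (Suc i)"
    and "e \<in> edges i \<Longrightarrow> \<Gamma> (Suc i) e \<in> [Z (Suc i) - Z i]\<^bsup>d\<^esup>"
    and "e \<in> edges i \<Longrightarrow> x \<in> e \<Longrightarrow> \<Gamma> (Suc i) e \<subseteq> neighbors E x"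
    and "disjoint_family_on (\<Gamma> (Suc i)) (edges i)"
proof -
  have "Suc i \<in> {1..r}"
    using assms by simp
  then show "Z i \<subseteq> Z (Suc i)"
    and "e \<in> edges i \<Longrightarrow> \<Gamma> (Suc i) e \<in> [Z (Suc i) - Z i]\<^bsup>d\<^esup>"
    and "e \<in> edges i \<Longrightarrow> x \<in> e \<Longrightarrow> \<Gamma> (Suc i) e \<subseteq> neighbors E x"
    and "disjoint_family_on (\<Gamma> (Suc i)) (edges i)"
    using phantom unfolding is_phantom_def by (metis diff_Suc_1)+
qed

lemma Z_mono:
  assumes "i \<le> j" "j \<le> r"
  shows "Z i \<subseteq> Z j"
  using assms
proof (induction j rule: dec_induct)
  case (step n)
  then show ?case
    using phantom_step(1)[of n] by simp
qed simp

lemma Z_subset_V: "i \<le> r \<Longrightarrow> Z i \<subseteq> V"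
  using Z_mono[of i r] phantom by (auto simp: is_phantom_def)

lemma attached:
  assumes "i < r" "e \<in> edges i"
  shows "\<Gamma> (Suc i) e \<subseteq> Z (Suc i) - Z i" "finite (\<Gamma> (Suc i) e)" "card (\<Gamma> (Suc i) e) = d"
    and "\<And>v x. v \<in> \<Gamma> (Suc i) e \<Longrightarrow> x \<in> e \<Longrightarrow> {v, x} \<in> E"
  using phantom_step(2)[OF assms] phantom_step(3)[OF assms]
  by (force simp: nsets_def neighbors_def insert_commute)+

lemma attached_disjoint:
  assumes "i < r" "e \<in> edges i" "e' \<in> edges i" "e \<noteq> e'"
  shows "\<Gamma> (Suc i) e \<inter> \<Gamma> (Suc i) e' = {}"
  using phantom_step(4)[OF assms(1)] assms(2-4) by (simp add: disjoint_family_on_def)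

section \<open>Growths of edges and their disjointness\<close>

lemma attached_edge:
  assumes "i < r" "e \<in> edges i" "v \<in> \<Gamma> (Suc i) e" "x \<in> e"
  shows "{v, x} \<in> edges (Suc i)"
  using attached[OF assms(1,2)] assms Z_mono[of i "Suc i"]
  by (auto simp: induced_edges_def)

text \<open>\<open>n\<close> counts the levels still to be grown, \<open>i\<close> is the level of
  the edge. The recursion follows only edges from a vertex just attached to an end of the edge it is
  attached to; whatever later levels attach to \<open>e\<close> itself, or to an edge between two
  vertices attached at the same level, is left out.\<close>

primrec growth :: "nat \<Rightarrow> nat \<Rightarrow> 'a set \<Rightarrow> 'a set" where
  "growth 0 i e = {}"
| "growth (Suc n) i e = (\<Union>v\<in>\<Gamma> (Suc i) e. insert v (\<Union>x\<in>e. growth n (Suc i) {v, x}))"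

lemma growth_subset:
  assumes "i + n \<le> r" "e \<in> edges i"
  shows "growth n i e \<subseteq> V - Z i"
  using assms
proof (induction n arbitrary: i e)
  case (Suc n)
  have i: "i < r"
    using Suc.prems by simp
  have "growth n (Suc i) {v, x} \<subseteq> V - Z i" if "v \<in> \<Gamma> (Suc i) e" "x \<in> e" for v x
    using Suc.IH[of "Suc i" "{v, x}"] attached_edge[OF i Suc.prems(2) that] Suc.prems(1)
      Z_mono[of i "Suc i"] by auto
  moreover have "\<Gamma> (Suc i) e \<subseteq> V - Z i"
    using attached(1)[OF i Suc.prems(2)] Z_subset_V[of "Suc i"] i by auto
  ultimately show ?case
    unfolding growth.simps by blast
qed simp

text \<open>Attached vertices lie in \<open>Z (Suc i)\<close> and deeper ones outside it, so the two
  kinds never meet. Attached sets of distinct edges are disjoint by the phantom axioms. Deeper parts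
  come from edges \<open>{v, x}\<close> and \<open>{v', x'}\<close>, which differ because
  \<open>v\<close> and \<open>v'\<close> are new and distinct while \<open>x\<close> and
  \<open>x'\<close> are old; induction applies to them.\<close>

lemma growth_disjoint:
  assumes "i + n \<le> r" "e \<in> edges i" "e' \<in> edges i" "e \<noteq> e'"
  shows "growth n i e \<inter> growth n i e' = {}"
  using assms
proof (induction n arbitrary: i e e')
  case (Suc n)
  have i: "i < r" and n: "Suc i + n \<le> r"
    using Suc.prems by simp_all
  have out: "growth n (Suc i) {v, x} \<inter> Z (Suc i) = {}"
    if "h \<in> edges i" "v \<in> \<Gamma> (Suc i) h" "x \<in> h" for h v x
    using growth_subset[OF n attached_edge[OF i that]] by blast
  have new: "\<Gamma> (Suc i) h \<subseteq> Z (Suc i)" if "h \<in> edges i" for h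
    using attached(1)[OF i that] by blast
  have old: "x \<notin> \<Gamma> (Suc i) h" if "h \<in> edges i" "h' \<in> edges i" "x \<in> h'" for h h' x
    using attached(1)[OF i that(1)] that by (auto simp: induced_edges_def)
  have "growth n (Suc i) {v, x} \<inter> growth n (Suc i) {v', x'} = {}"
    if "v \<in> \<Gamma> (Suc i) e" "x \<in> e" "v' \<in> \<Gamma> (Suc i) e'" "x' \<in> e'" for v x v' x'
  proof (rule Suc.IH[OF n])
    show "{v, x} \<in> edges (Suc i)" "{v', x'} \<in> edges (Suc i)"
      using that attached_edge[OF i] Suc.prems by auto
    show "{v, x} \<noteq> {v', x'}"
      using that attached_disjoint[OF i Suc.prems(2-4)] old[OF Suc.prems(2,3)]
      by (metis disjoint_iff doubleton_eq_iff)
  qed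
  note deep = this
  show ?case
  proof (rule equals0I)
    fix u assume "u \<in> growth (Suc n) i e \<inter> growth (Suc n) i e'"
    then obtain v v' where v: "v \<in> \<Gamma> (Suc i) e" "u = v \<or> (\<exists>x\<in>e. u \<in> growth n (Suc i) {v, x})"
      and v': "v' \<in> \<Gamma> (Suc i) e'" "u = v' \<or> (\<exists>x\<in>e'. u \<in> growth n (Suc i) {v', x})"
      by auto
    show False
    proof (cases "u \<in> Z (Suc i)")
      case True
      then have "u = v" "u = v'"
        using v v' out Suc.prems(2,3) by blast+
      then show False
        using v(1) v'(1) attached_disjoint[OF i Suc.prems(2-4)] by blast
    next
      case False
      then show False
        using v v' new[OF Suc.prems(2)] new[OF Suc.prems(3)] deep by blast
    qed
  qed
qed simp

section \<open>Crystals from large unshared sets\<close>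

definition unshared :: "nat \<Rightarrow> nat \<Rightarrow> 'a \<Rightarrow> 'a \<Rightarrow> 'a \<Rightarrow> 'a set" where
  "unshared n i v x y = {u \<in> growth n i {v, x}. {u, v} \<in> E \<and> {u, x} \<in> E \<and> {u, y} \<notin> E}"

lemma unshared_subset:
  assumes "i + n \<le> r" "{v, x} \<in> edges i"
  shows "unshared n i v x y \<subseteq> V - Z i"
  using growth_subset[OF assms] by (auto simp: unshared_def)

text \<open>\<open>S\<close> consists of \<open>f\<close> of the counted vertices, and the sets of
  the crystal are \<open>g\<close>-subsets of the unshared sets. These have the prescribed
  adjacencies by definition, and they lie in growths of distinct edges of level
  \<open>Suc i\<close>, hence are disjoint and avoid \<open>S\<close>, \<open>x\<close> and
  \<open>y\<close>.\<close>

lemma has_crystal: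
  assumes i: "i + Suc n \<le> r" and e: "{x, y} \<in> edges i"
    and f: "f \<le> card {v \<in> \<Gamma> (Suc i) {x, y}.
      g \<le> card (unshared n (Suc i) v x y) \<and> g \<le> card (unshared n (Suc i) v y x)}"
      (is "_ \<le> card ?B")
  shows "has_crystal V E f g"
proof -
  have i': "i < r" and n: "Suc i + n \<le> r"
    using i by simp_all
  obtain S where S: "S \<subseteq> ?B" "card S = f" "finite S"
    by (rule obtain_subset_with_card_n[OF f])
  have SZ: "S \<subseteq> Z (Suc i) - Z i"
    using S(1) attached(1)[OF i' e] by blast
  have xyZ: "x \<in> Z i" "y \<in> Z i" and xyE: "{x, y} \<in> E"
    using e by (auto simp: induced_edges_def)
  have Z: "Z i \<subseteq> Z (Suc i)" "Z (Suc i) \<subseteq> V"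
    using Z_mono[of i "Suc i"] Z_subset_V[of "Suc i"] i' by simp_all
  have edge: "{v, x} \<in> edges (Suc i)" "{v, y} \<in> edges (Suc i)" if "v \<in> S" for v
    using attached_edge[OF i' e] S(1) that by blast+
  have "\<exists>P. P \<subseteq> unshared n (Suc i) v x y \<and> card P = g \<and> finite P" if "v \<in> S" for v
  proof -
    have "g \<le> card (unshared n (Suc i) v x y)"
      using S(1) that by blast
    then show ?thesis
      by (rule obtain_subset_with_card_n) blast
  qed
  then obtain P where P: "\<And>v. v \<in> S \<Longrightarrow> P v \<subseteq> unshared n (Suc i) v x y"
      "\<And>v. v \<in> S \<Longrightarrow> card (P v) = g" "\<And>v. v \<in> S \<Longrightarrow> finite (P v)"
    by metis
  have "\<exists>P. P \<subseteq> unshared n (Suc i) v y x \<and> card P = g \<and> finite P" if "v \<in> S" for v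
  proof -
    have "g \<le> card (unshared n (Suc i) v y x)"
      using S(1) that by blast
    then show ?thesis
      by (rule obtain_subset_with_card_n) blast
  qed
  then obtain Q where Q: "\<And>v. v \<in> S \<Longrightarrow> Q v \<subseteq> unshared n (Suc i) v y x"
      "\<And>v. v \<in> S \<Longrightarrow> card (Q v) = g" "\<And>v. v \<in> S \<Longrightarrow> finite (Q v)"
    by metis
  have PQ: "P v \<subseteq> V - Z (Suc i)" "Q v \<subseteq> V - Z (Suc i)" if "v \<in> S" for v
    using P(1)[OF that] Q(1)[OF that] unshared_subset[OF n edge(1)[OF that]]
      unshared_subset[OF n edge(2)[OF that]] by blast+
  have grow: "P v \<subseteq> growth n (Suc i) {v, x}" "Q v \<subseteq> growth n (Suc i) {v, y}" if "v \<in> S" for v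
    using P(1)[OF that] Q(1)[OF that] by (auto simp: unshared_def)
  define T where "T j v = (if j = (1::nat) then P v else Q v)" for j v
  have xy: "x \<noteq> y"
    using xyE by (rule edge_neq)
  have "is_crystal V E x y f g S T"
    unfolding is_crystal_def
  proof (intro conjI)
    show "S \<in> [V - {x, y}]\<^bsup>f\<^esup>"
      using S SZ xyZ Z by (auto simp: nsets_def)
    have "S \<union> {x, y} \<subseteq> Z (Suc i)"
      using SZ xyZ Z by blast
    then have "P v \<subseteq> V - (S \<union> {x, y})" "Q v \<subseteq> V - (S \<union> {x, y})" if "v \<in> S" for v
      using PQ[OF that] by blast+
    then show "\<forall>j\<in>{1, 2}. \<forall>z\<in>S. T j z \<in> [V - (S \<union> {x, y})]\<^bsup>g\<^esup>"
      using P(2,3) Q(2,3) by (simp add: T_def nsets_def)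
    have disj: "growth n (Suc i) {v, a} \<inter> growth n (Suc i) {w, b} = {}"
      if "v \<in> S" "w \<in> S" "a \<in> {x, y}" "b \<in> {x, y}" "v \<noteq> w \<or> a \<noteq> b" for v w a b
    proof (rule growth_disjoint[OF n])
      show "{v, a} \<in> edges (Suc i)" "{w, b} \<in> edges (Suc i)"
        using that(3,4) edge[OF that(1)] edge[OF that(2)] by blast+
      have "v \<notin> {x, y}" "w \<notin> {x, y}"
        using that(1,2) SZ xyZ by blast+
      then show "{v, a} \<noteq> {w, b}"
        using that(3-5) by (metis doubleton_eq_iff)
    qed
    have T: "T 1 v \<subseteq> growth n (Suc i) {v, x}" "T 2 v \<subseteq> growth n (Suc i) {v, y}" if "v \<in> S" for v
      using grow[OF that] by (simp_all add: T_def)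
    show "disjoint_family_on (\<lambda>(j, z). T j z) ({1, 2} \<times> S)"
      unfolding disjoint_family_on_def
    proof (intro ballI impI)
      fix p q :: "nat \<times> 'a"
      assume pq: "p \<in> {1, 2} \<times> S" "q \<in> {1, 2} \<times> S" "p \<noteq> q"
      obtain j v k w where p: "p = (j, v)" and q: "q = (k, w)"
        by (meson surj_pair)
      \<comment> \<open>The crystal index 1 belongs to \<open>x\<close> and 2 to \<open>y\<close>;
        as \<open>x\<close> and \<open>y\<close> differ, distinct index pairs give distinct edges
        \<open>{z, side l}\<close>.\<close>
      define side where "side l = (if l = (1::nat) then x else y)" for l
      have T_side: "T l z \<subseteq> growth n (Suc i) {z, side l}" if "l \<in> {1, 2}" "z \<in> S" for l z
        using T[OF that(2)] that(1) by (auto simp: side_def)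
      have mem: "j \<in> {1, 2}" "k \<in> {1, 2}" "v \<in> S" "w \<in> S" and "v \<noteq> w \<or> j \<noteq> k"
        using pq p q by auto
      moreover have "side j \<in> {x, y}" "side k \<in> {x, y}" "j \<noteq> k \<longrightarrow> side j \<noteq> side k"
        using mem(1,2) xy by (auto simp: side_def)
      ultimately have "growth n (Suc i) {v, side j} \<inter> growth n (Suc i) {w, side k} = {}"
        by (intro disj) simp_all
      then have "T j v \<inter> T k w = {}"
        using T_side[OF mem(1,3)] T_side[OF mem(2,4)] by blast
      then show "(case p of (j, z) \<Rightarrow> T j z) \<inter> (case q of (j, z) \<Rightarrow> T j z) = {}"
        by (simp add: p q)
    qed
    show "\<forall>z\<in>S. \<forall>u\<in>T 1 z. neighbors E u \<inter> {x, y, z} = {x, z}"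
    proof (intro ballI)
      fix z u assume "z \<in> S" "u \<in> T 1 z"
      then have "u \<in> unshared n (Suc i) z x y"
        using P(1) by (auto simp: T_def)
      then show "neighbors E u \<inter> {x, y, z} = {x, z}"
        by (auto simp: unshared_def neighbors_def)
    qed
    show "\<forall>z\<in>S. \<forall>u\<in>T 2 z. neighbors E u \<inter> {x, y, z} = {y, z}"
    proof (intro ballI)
      fix z u assume "z \<in> S" "u \<in> T 2 z"
      then have "u \<in> unshared n (Suc i) z y x"
        using Q(1) by (auto simp: T_def)
      then show "neighbors E u \<inter> {x, y, z} = {y, z}"
        by (auto simp: unshared_def neighbors_def)
    qed
  qed
  then show ?thesis
    using xyE xyZ Z by (auto simp: has_crystal_def)
qed

section \<open>Enlarging a clique level by level\<close>

definition guarded_clique :: "nat \<Rightarrow> nat \<Rightarrow> nat \<Rightarrow> 'a set \<Rightarrow> 'a \<Rightarrow> 'a \<Rightarrow> bool" where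
  "guarded_clique g n i K x y \<longleftrightarrow>
     is_clique_of_size V E (i + 2) K \<and> {x, y} \<in> edges i \<and> x \<in> K \<and> y \<in> K \<and> K \<subseteq> Z i \<and>
     (\<exists>M. finite M \<and> card M < g \<and>
       (\<forall>u\<in>growth n i {x, y} - M. {u, x} \<in> E \<longrightarrow> {u, y} \<in> E \<longrightarrow> (\<forall>k\<in>K. {u, k} \<in> E)))"

text \<open>The exception set is replaced, not enlarged: the new vertex \<open>v\<close> is chosen
  so that the old exceptions \<open>M\<close> miss the growths of \<open>{v, x}\<close> and
  \<open>{v, y}\<close>, and an unshared set of size below \<open>g\<close> takes over.\<close>

lemma guarded_clique_Suc:
  assumes d: "d = f + g" and free: "\<not> has_crystal V E f g" and i: "i + Suc n \<le> r"
    and K: "guarded_clique g (Suc n) i K x y"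
  shows "\<exists>K x y. guarded_clique g n (Suc i) K x y"
proof -
  have i': "i < r" and n: "Suc i + n \<le> r"
    using i by simp_all
  obtain M where M: "finite M" "card M < g"
      "\<And>u k. u \<in> growth (Suc n) i {x, y} \<Longrightarrow> u \<notin> M \<Longrightarrow> {u, x} \<in> E \<Longrightarrow> {u, y} \<in> E \<Longrightarrow> k \<in> K
        \<Longrightarrow> {u, k} \<in> E"
    using K unfolding guarded_clique_def by blast
  have K': "is_clique_of_size V E (i + 2) K" and e: "{x, y} \<in> edges i" and xyK: "x \<in> K" "y \<in> K"
    and KZ: "K \<subseteq> Z i"
    using K unfolding guarded_clique_def by blast+
  note \<Gamma> = attached[OF i' e]
  let ?C = "\<Gamma> (Suc i) {x, y}"
  let ?B = "{v \<in> ?C. g \<le> card (unshared n (Suc i) v x y) \<and> g \<le> card (unshared n (Suc i) v y x)}"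
  define N where "N = ?C - ?B"
  \<comment> \<open>\<open>F v\<close> contains \<open>v\<close> itself so that avoiding
    \<open>M\<close> also makes \<open>v\<close> adjacent to all of \<open>K\<close>.\<close>
  define F where "F v = insert v (growth n (Suc i) {v, x} \<union> growth n (Suc i) {v, y})" for v
  have "card ?B < f"
    using has_crystal[OF i e] free by (meson not_le)
  then have many: "g < card N"
    unfolding N_def using \<Gamma>(2,3) d card_Diff_subset[of ?B ?C] by simp
  have disj: "F v \<inter> F w = {}" if vw: "v \<in> ?C" "w \<in> ?C" "v \<noteq> w" for v w
  proof -
    have edge: "{v, a} \<in> edges (Suc i)" "{w, a} \<in> edges (Suc i)" if "a \<in> {x, y}" for a
      using attached_edge[OF i' e] vw that by auto
    have "v \<notin> Z i" "w \<notin> Z i" "v \<in> Z (Suc i)" "w \<in> Z (Suc i)" "x \<in> Z i" "y \<in> Z i"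
      using \<Gamma>(1) vw xyK KZ by blast+
    have D: "growth n (Suc i) {v, a} \<inter> growth n (Suc i) {w, b} = {}"
      "v \<notin> growth n (Suc i) {w, b}" "w \<notin> growth n (Suc i) {v, a}"
      if ab: "a \<in> {x, y}" "b \<in> {x, y}" for a b
    proof -
      have "{v, a} \<noteq> {w, b}"
        using vw(3) ab \<open>v \<notin> Z i\<close> \<open>x \<in> Z i\<close> \<open>y \<in> Z i\<close>
        by (metis doubleton_eq_iff insert_iff singletonD)
      then show "growth n (Suc i) {v, a} \<inter> growth n (Suc i) {w, b} = {}"
        by (rule growth_disjoint[OF n edge(1)[OF ab(1)] edge(2)[OF ab(2)]])
      show "v \<notin> growth n (Suc i) {w, b}" "w \<notin> growth n (Suc i) {v, a}"
        using \<open>v \<in> Z (Suc i)\<close> \<open>w \<in> Z (Suc i)\<close>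
          growth_subset[OF n edge(2)[OF ab(2)]] growth_subset[OF n edge(1)[OF ab(1)]] by blast+
    qed
    have xy: "x \<in> {x, y}" "y \<in> {x, y}"
      by simp_all
    show ?thesis
      using vw(3) D(1)[OF xy(1) xy(1)] D(1)[OF xy] D(1)[OF xy(2) xy(1)] D(1)[OF xy(2) xy(2)]
        D(2,3)[OF xy(1) xy(1)] D(2,3)[OF xy(2) xy(2)]
      by (simp add: F_def Int_Un_distrib Int_Un_distrib2)
  qed
  \<comment> \<open>Pigeonhole: otherwise picking a point of \<open>M\<close> in each of the
    disjoint sets \<open>F v\<close> would inject \<open>N\<close> into the smaller set
    \<open>M\<close>.\<close>
  have "\<exists>v\<in>N. F v \<inter> M = {}"
  proof (rule ccontr)
    assume "\<not> ?thesis"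
    then have "\<forall>v\<in>N. \<exists>u. u \<in> F v \<inter> M"
      by blast
    then obtain m where m: "\<forall>v\<in>N. m v \<in> F v \<inter> M"
      by (rule bchoice[THEN exE])
    have "inj_on m N"
    proof (rule inj_onI, rule ccontr)
      fix v w assume vw: "v \<in> N" "w \<in> N" "m v = m w" "v \<noteq> w"
      then have "F v \<inter> F w = {}"
        by (intro disj) (auto simp: N_def)
      then show False
        using m vw(1-3) by (metis IntD1 disjoint_iff)
    qed
    then have "card N \<le> card M"
      using m M(1) by (intro card_inj_on_le[of m]) auto
    then show False
      using many M(2) by simp
  qed
  then obtain v where "v \<in> N" and vM: "F v \<inter> M = {}"
    by blast
  then have v: "v \<in> ?C" "v \<notin> ?B"
    by (simp_all add: N_def)
  have vE: "{v, x} \<in> E" "{v, y} \<in> E"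
    using \<Gamma>(4)[OF v(1)] by auto
  have grow: "growth n (Suc i) {v, a} \<subseteq> growth (Suc n) i {x, y} - M" if "a \<in> {x, y}" for a
    using v(1) vM that by (auto simp: F_def)
  have vK: "{v, k} \<in> E" if "k \<in> K" for k
    using M(3)[of v k] v(1) vM vE that by (auto simp: F_def)
  have "v \<notin> K" "v \<in> V" "K \<subseteq> V"
    using v(1) \<Gamma>(1) KZ Z_subset_V[of "Suc i"] Z_subset_V[of i] i' by auto
  then have clique: "is_clique_of_size V E (Suc i + 2) (insert v K)"
    using K' vK by (auto simp: is_clique_of_size_def nsets_def clique_def insert_commute)
  have sub: "insert v K \<subseteq> Z (Suc i)"
    using v(1) \<Gamma>(1) KZ Z_mono[of i "Suc i"] i' by auto
  \<comment> \<open>The pair \<open>a\<close>, \<open>b\<close> is \<open>x\<close>,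
    \<open>y\<close> in either order, which covers both choices of the small unshared set.\<close>
  have "guarded_clique g n (Suc i) (insert v K) v a"
    if ab: "{a, b} = {x, y}" and few: "card (unshared n (Suc i) v a b) < g" for a b
    unfolding guarded_clique_def
  proof (intro conjI exI[of _ "unshared n (Suc i) v a b"] ballI impI)
    have a: "a \<in> {x, y}" "a \<in> K" and va: "{v, a} \<in> edges (Suc i)"
      using ab xyK attached_edge[OF i' e v(1)] by (auto simp: doubleton_eq_iff)
    show "{v, a} \<in> edges (Suc i)" "a \<in> insert v K"
      using a va by auto
    \<comment> \<open>Finiteness matters because \<open>card\<close> of an infinite set is
      0.\<close>
    show "finite (unshared n (Suc i) v a b)"
      using unshared_subset[OF n va] finite_V by (meson finite_Diff finite_subset)
    fix u k
    assume u: "u \<in> growth n (Suc i) {v, a} - unshared n (Suc i) v a b"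
      and uE: "{u, v} \<in> E" "{u, a} \<in> E" and k: "k \<in> insert v K"
    \<comment> \<open>Not being an exception, \<open>u\<close> is adjacent to \<open>b\<close> as
      well, so the old invariant for \<open>x\<close>, \<open>y\<close> applies to it.\<close>
    have "{u, b} \<in> E"
      using u uE by (auto simp: unshared_def)
    then have "{u, x} \<in> E" "{u, y} \<in> E"
      using uE ab by (auto simp: doubleton_eq_iff)
    then show "{u, k} \<in> E"
      using M(3)[of u k] grow[OF a(1)] u uE k by auto
  qed (use clique sub few in auto)
  moreover have "card (unshared n (Suc i) v x y) < g \<or> card (unshared n (Suc i) v y x) < g"
    using v by auto
  ultimately show ?thesis
    by (metis insert_commute)
qed

text \<open>Each step uses up one remaining level and adds one vertex to the clique.\<close>

lemma guarded_clique_exists: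
  assumes d: "d = f + g" and g: "g \<ge> 1" and free: "\<not> has_crystal V E f g"
    and Z\<^sub>0: "is_clique_of_size V E 2 Z\<^sub>0" and i: "i \<le> r"
  shows "\<exists>K x y. guarded_clique g (r - i) i K x y"
  using i
proof (induction i)
  case 0
  obtain x y where xy: "Z\<^sub>0 = {x, y}" "x \<noteq> y"
    using Z\<^sub>0 by (auto simp: is_clique_of_size_def nsets_def card_2_iff)
  have "Z 0 = Z\<^sub>0"
    using phantom by (simp add: is_phantom_def)
  moreover have "{x, y} \<in> E"
    using Z\<^sub>0 xy by (auto simp: is_clique_of_size_def clique_def)
  \<comment> \<open>The clique is just the edge \<open>{x, y}\<close>, so there are no exceptions,
    and the empty set has fewer than \<open>g\<close> elements because \<open>g\<close> is
    positive.\<close>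
  ultimately have "guarded_clique g r 0 Z\<^sub>0 x y"
    using xy Z\<^sub>0 g unfolding guarded_clique_def
    by (auto simp: induced_edges_def numeral_2_eq_2 intro!: exI[of _ "{}"])
  then show ?case
    by auto
next
  case (Suc i)
  have "r - i = Suc (r - Suc i)"
    using Suc.prems by simp
  then show ?case
    using Suc guarded_clique_Suc[OF d free, of i "r - Suc i"] by auto
qed

end

theorem theorem3p3:
  fixes V :: "'a set" and E :: "'a set set" and f g t :: nat
  assumes "f \<ge> 1" and "g \<ge> 1" and "t \<ge> 1"
    and "fin_simple_graph V E"
    and "clique_free V E t"
    and "\<exists>Z\<^sub>0. is_clique_of_size V E 2 Z\<^sub>0 \<and> has_phantom V E Z\<^sub>0 (f + g) t"
  shows "has_crystal V E f g"
proof (rule ccontr)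
  assume free: "\<not> has_crystal V E f g"
  obtain Z\<^sub>0 Z \<Gamma> where Z\<^sub>0: "is_clique_of_size V E 2 Z\<^sub>0" and "is_phantom V E Z\<^sub>0 (f + g) t Z \<Gamma>"
    using assms(6) by (auto simp: has_phantom_def)
  then interpret phantom V E Z\<^sub>0 "f + g" t Z \<Gamma>
    using assms(4) by unfold_locales
  \<comment> \<open>After all \<open>t\<close> levels the clique has \<open>t + 2\<close> vertices;
    any \<open>t\<close> of them contradict clique-freeness.\<close>
  obtain K where K: "is_clique_of_size V E (t + 2) K"
    using guarded_clique_exists[OF refl assms(2) free Z\<^sub>0 order_refl]
    by (auto simp: guarded_clique_def)
  then have "t \<le> card K"
    by (simp add: is_clique_of_size_def nsets_def)
  then obtain L where "L \<subseteq> K" "card L = t" "finite L"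
    by (rule obtain_subset_with_card_n)
  then have "is_clique_of_size V E t L"
    using K by (auto simp: is_clique_of_size_def nsets_def clique_def)
  then show False
    using assms(5) by (simp add: clique_free_def)
qed

end
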